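(* Let $\Delta$ be an orthogonal polar space of rank $n\ge 3$ over a field of characteristic not $2$. Every collineation $\theta$ of $\Delta$ with opposition diagram $\mathrm{Diag}(\theta)=\mathsf{B}_{n;1}^1$ pointwise fixes a nondegenerate geometric hyperplane. Also, $\theta$ is an involution.
   Context: An orthogonal polar space arises from a nondegenerate quadric (of Witt index $n$) in a projective space over a commutative field. Points are opposite iff non-collinear; singular subspaces $X,Y$ are opposite iff they have the same projective dimension and every point of $X$ is opposite some point of $Y$. $\mathrm{Diag}(\theta)=\mathsf B_{n;1}^1$ means that $\theta$ maps some point to an opposite point, but maps no singular subspace of positive dimension to an opposite one. A subspace is a set of points containing every line that meets it in at least two points. A geometric hyperplane is a subspace meeting every line in at least one point, and meeting at least one line in exactly one point. It is singular if it equals $p^\perp$ (the set of points collinear or equal to $p$) for some point $p$, and nondegenerate otherwise. *)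

theory Defs
  imports Complex_Main
begin

section \<open>Point-line geometries\<close>

text \<open>A geometry is given by its point set \<open>P\<close> and its set of lines \<open>LL\<close>, each line being
  the set of its points.\<close>

definition collinear :: "'p set set \<Rightarrow> 'p \<Rightarrow> 'p \<Rightarrow> bool" where
  "collinear LL p x \<longleftrightarrow> (\<exists>L\<in>LL. p \<in> L \<and> x \<in> L)"

definition perp :: "'p set \<Rightarrow> 'p set set \<Rightarrow> 'p \<Rightarrow> 'p set" where
  "perp P LL p = {x \<in> P. x = p \<or> collinear LL x p}"

definition opposite_points :: "'p set set \<Rightarrow> 'p \<Rightarrow> 'p \<Rightarrow> bool" where
  "opposite_points LL p x \<longleftrightarrow> p \<noteq> x \<and> \<not> collinear LL p x"

definition geom_subspace :: "'p set \<Rightarrow> 'p set set \<Rightarrow> 'p set \<Rightarrow> bool" where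
  "geom_subspace P LL S \<longleftrightarrow>
     S \<subseteq> P \<and> (\<forall>L\<in>LL. (\<exists>x\<in>L \<inter> S. \<exists>y\<in>L \<inter> S. x \<noteq> y) \<longrightarrow> L \<subseteq> S)"

definition singular_subspace :: "'p set \<Rightarrow> 'p set set \<Rightarrow> 'p set \<Rightarrow> bool" where
  "singular_subspace P LL S \<longleftrightarrow>
     geom_subspace P LL S \<and> (\<forall>x\<in>S. \<forall>y\<in>S. x = y \<or> collinear LL x y)"

definition geometric_hyperplane :: "'p set \<Rightarrow> 'p set set \<Rightarrow> 'p set \<Rightarrow> bool" where
  "geometric_hyperplane P LL H \<longleftrightarrow>
     geom_subspace P LL H \<and> (\<forall>L\<in>LL. L \<inter> H \<noteq> {}) \<and> (\<exists>L\<in>LL. \<exists>!x. x \<in> L \<inter> H)"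

definition singular_hyperplane :: "'p set \<Rightarrow> 'p set set \<Rightarrow> 'p set \<Rightarrow> bool" where
  "singular_hyperplane P LL H \<longleftrightarrow>
     geometric_hyperplane P LL H \<and> (\<exists>p\<in>P. H = perp P LL p)"

definition nondegenerate_hyperplane :: "'p set \<Rightarrow> 'p set set \<Rightarrow> 'p set \<Rightarrow> bool" where
  "nondegenerate_hyperplane P LL H \<longleftrightarrow>
     geometric_hyperplane P LL H \<and> \<not> singular_hyperplane P LL H"

definition collineation :: "'p set \<Rightarrow> 'p set set \<Rightarrow> ('p \<Rightarrow> 'p) \<Rightarrow> bool" where
  "collineation P LL \<theta> \<longleftrightarrow>
     bij_betw \<theta> P P \<and> (\<forall>L. L \<subseteq> P \<longrightarrow> (\<theta> ` L \<in> LL \<longleftrightarrow> L \<in> LL))"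

text \<open>An involution has order exactly two; the values of \<open>\<theta>\<close> outside the point set \<open>P\<close> are
  irrelevant.\<close>

definition involution_on :: "'p set \<Rightarrow> ('p \<Rightarrow> 'p) \<Rightarrow> bool" where
  "involution_on P \<theta> \<longleftrightarrow> (\<forall>x\<in>P. \<theta> (\<theta> x) = x) \<and> (\<exists>x\<in>P. \<theta> x \<noteq> x)"


section \<open>Orthogonal polar spaces\<close>

text \<open>The vector space is the whole type \<open>'v\<close>, with scalar multiplication \<open>scale\<close> over the
  field \<open>'k\<close>; its dimension may be infinite.\<close>

definition polar_form :: "('v::ab_group_add \<Rightarrow> 'k::field) \<Rightarrow> 'v \<Rightarrow> 'v \<Rightarrow> 'k" where
  "polar_form q v w = q (v + w) - q v - q w"

text \<open>The polar form is symmetric, so linearity in one argument gives bilinearity.\<close>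

definition quadratic_form ::
    "('k::field \<Rightarrow> 'v::ab_group_add \<Rightarrow> 'v) \<Rightarrow> ('v \<Rightarrow> 'k) \<Rightarrow> bool" where
  "quadratic_form scale q \<longleftrightarrow>
     (\<forall>a v. q (scale a v) = a\<^sup>2 * q v) \<and>
     (\<forall>v. Vector_Spaces.linear scale (*) (polar_form q v))"

text \<open>The quadric \<open>q = 0\<close> is nondegenerate if it has no vertex. This is the usual notion in
  every characteristic; when the characteristic is not 2 it says that the radical of the polar
  form is zero.\<close>

definition nondegenerate_form :: "('v::ab_group_add \<Rightarrow> 'k::field) \<Rightarrow> bool" where
  "nondegenerate_form q \<longleftrightarrow> (\<forall>v. q v = 0 \<and> (\<forall>w. polar_form q v w = 0) \<longrightarrow> v = 0)"

definition totally_singular ::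
    "('k::field \<Rightarrow> 'v::ab_group_add \<Rightarrow> 'v) \<Rightarrow> ('v \<Rightarrow> 'k) \<Rightarrow> 'v set \<Rightarrow> bool" where
  "totally_singular scale q U \<longleftrightarrow> module.subspace scale U \<and> (\<forall>u\<in>U. q u = 0)"

text \<open>The library function \<open>dim\<close> is 0 on infinite-dimensional subspaces, so the Witt index
  (the largest vector-space dimension of a totally singular subspace) is expressed by bases.\<close>

definition has_witt_index ::
    "('k::field \<Rightarrow> 'v::ab_group_add \<Rightarrow> 'v) \<Rightarrow> ('v \<Rightarrow> 'k) \<Rightarrow> nat \<Rightarrow> bool" where
  "has_witt_index scale q n \<longleftrightarrow>
     (\<exists>B. \<not> module.dependent scale B \<and> totally_singular scale q (module.span scale B) \<and>
          finite B \<and> card B = n) \<and>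
     (\<forall>B. \<not> module.dependent scale B \<and> totally_singular scale q (module.span scale B) \<longrightarrow>
          finite B \<and> card B \<le> n)"

definition orthogonal_polar_space ::
    "('k::field \<Rightarrow> 'v::ab_group_add \<Rightarrow> 'v) \<Rightarrow> ('v \<Rightarrow> 'k) \<Rightarrow> nat \<Rightarrow> bool" where
  "orthogonal_polar_space scale q n \<longleftrightarrow>
     vector_space scale \<and> quadratic_form scale q \<and> nondegenerate_form q \<and>
     has_witt_index scale q n"

text \<open>Points of the projective space are one-dimensional vector subspaces.\<close>

definition quadric_points ::
    "('k::field \<Rightarrow> 'v::ab_group_add \<Rightarrow> 'v) \<Rightarrow> ('v \<Rightarrow> 'k) \<Rightarrow> 'v set set" where
  "quadric_points scale q = {module.span scale {v} | v. v \<noteq> 0 \<and> q v = 0}"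

definition quadric_lines ::
    "('k::field \<Rightarrow> 'v::ab_group_add \<Rightarrow> 'v) \<Rightarrow> ('v \<Rightarrow> 'k) \<Rightarrow> 'v set set set" where
  "quadric_lines scale q =
     {{p \<in> quadric_points scale q. p \<subseteq> U} | U.
        totally_singular scale q U \<and> vector_space.dim scale U = 2}"

text \<open>The projective dimension of a set of points is one less than the vector-space dimension of
  the subspace they generate (\<open>vector_space.dim\<close> of a set is that of its span). Singular subspaces
  have finite dimension because the Witt index is finite.\<close>

definition proj_dim ::
    "('k::field \<Rightarrow> 'v::ab_group_add \<Rightarrow> 'v) \<Rightarrow> 'v set set \<Rightarrow> int" where
  "proj_dim scale X = int (vector_space.dim scale (\<Union>X)) - 1"

definition opposite_subspaces ::
    "('k::field \<Rightarrow> 'v::ab_group_add \<Rightarrow> 'v) \<Rightarrow> ('v \<Rightarrow> 'k) \<Rightarrow> 'v set set \<Rightarrow> 'v set set \<Rightarrow> bool" where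
  "opposite_subspaces scale q X Y \<longleftrightarrow>
     proj_dim scale X = proj_dim scale Y \<and>
     (\<forall>x\<in>X. \<exists>y\<in>Y. opposite_points (quadric_lines scale q) x y)"

text \<open>\<open>Diag_B1_1 scale q \<theta>\<close> stands for \<open>Diag(\<theta>) = B\<^bsub>n;1\<^esub>\<^sup>1\<close>; the index \<open>n\<close> is the rank of the
  polar space.\<close>

definition Diag_B1_1 ::
    "('k::field \<Rightarrow> 'v::ab_group_add \<Rightarrow> 'v) \<Rightarrow> ('v \<Rightarrow> 'k) \<Rightarrow> ('v set \<Rightarrow> 'v set) \<Rightarrow> bool" where
  "Diag_B1_1 scale q \<theta> \<longleftrightarrow>
     (\<exists>p\<in>quadric_points scale q. opposite_points (quadric_lines scale q) p (\<theta> p)) \<and>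
     (\<forall>X. singular_subspace (quadric_points scale q) (quadric_lines scale q) X \<and>
          proj_dim scale X > 0 \<longrightarrow> \<not> opposite_subspaces scale q X (\<theta> ` X))"

end

theory Submission
  imports Defs
begin

text \<open>Let \<open>p\<close> be a point opposite \<open>\<theta> p\<close>, and let \<open>\<Gamma>\<close> be the set of points collinear with both.
  Domesticity of the lines through \<open>p\<close> and of the lines in \<open>\<Gamma>\<close> shows that the map
  \<open>x \<mapsto> \<theta>(px) \<inter> p\<^sup>\<perp>\<close> of \<open>\<Gamma>\<close> maps every point \<open>x\<close> to a point collinear with
  \<open>x\<^sup>\<perp> \<inter> \<Gamma>\<close>, hence to \<open>x\<close> itself. So every line through \<open>p\<close> meets its image in a point of
  \<open>\<Gamma>\<close>, and comparing \<open>p\<close> with another point of a line \<open>px\<close> that is mapped to an opposite one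
  shows that \<open>\<theta>\<close> fixes \<open>\<Gamma>\<close> pointwise. Since \<open>{p, \<theta> p}\<^sup>\<perp>\<^sup>\<perp> = {p, \<theta> p}\<close>, it follows that
  every point is fixed or mapped to an opposite point, that the fixed points form a hyperplane not of
  the form \<open>a\<^sup>\<perp>\<close>, and that \<open>\<theta>\<^sup>2 p = p\<close>.\<close>

section \<open>Line-domestic collineations\<close>

definition coll_eq :: "'p set set \<Rightarrow> 'p \<Rightarrow> 'p \<Rightarrow> bool" where
  "coll_eq LL x y \<longleftrightarrow> x = y \<or> collinear LL x y"

lemma coll_eq_refl [simp]: "coll_eq LL x x"
  by (simp add: coll_eq_def)

lemma coll_eq_sym: "coll_eq LL x y \<Longrightarrow> coll_eq LL y x"
  by (auto simp: coll_eq_def collinear_def)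

lemma coll_eq_on_line: "L \<in> LL \<Longrightarrow> x \<in> L \<Longrightarrow> y \<in> L \<Longrightarrow> coll_eq LL x y"
  by (auto simp: coll_eq_def collinear_def)

lemma opposite_points_iff: "opposite_points LL x y \<longleftrightarrow> \<not> coll_eq LL x y"
  by (simp add: opposite_points_def coll_eq_def)

text \<open>The incidence facts on which the argument rests; they are derived for quadrics by the
  later \<open>sublocale\<close>. \<open>fourth_point\<close> gives every line at least four points,
  which uses characteristic not 2. \<open>perp_pair_line\<close> reflects rank at least 3: the
  common perp of two opposite points contains lines.\<close>

locale polar_geometry =
  fixes P :: "'p set" and LL :: "'p set set"
  assumes line_subset: "L \<in> LL \<Longrightarrow> L \<subseteq> P"
    and line_unique:
      "\<lbrakk>L \<in> LL; M \<in> LL; x \<in> L; y \<in> L; x \<in> M; y \<in> M; x \<noteq> y\<rbrakk> \<Longrightarrow> L = M"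
    and perp_line:
      "\<lbrakk>L \<in> LL; y \<in> L; z \<in> L; w \<in> L; y \<noteq> z; x \<in> P; coll_eq LL x y; coll_eq LL x z\<rbrakk>
        \<Longrightarrow> coll_eq LL x w"
    and perp_meets_line: "\<lbrakk>L \<in> LL; x \<in> P\<rbrakk> \<Longrightarrow> \<exists>y\<in>L. coll_eq LL x y"
    and fourth_point: "L \<in> LL \<Longrightarrow> \<exists>d\<in>L. d \<noteq> a \<and> d \<noteq> b \<and> d \<noteq> c"
    and double_perp:
      "\<lbrakk>p \<in> P; p' \<in> P; r \<in> P; \<not> coll_eq LL p p';
        \<And>x. \<lbrakk>x \<in> P; coll_eq LL p x; coll_eq LL p' x\<rbrakk> \<Longrightarrow> coll_eq LL r x\<rbrakk>
        \<Longrightarrow> r = p \<or> r = p'"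
    and separating_point:
      "\<lbrakk>p \<in> P; p' \<in> P; x \<in> P; y \<in> P; \<not> coll_eq LL p p'; x \<noteq> y; coll_eq LL x y;
        coll_eq LL p x; coll_eq LL p' x; coll_eq LL p y; coll_eq LL p' y\<rbrakk>
        \<Longrightarrow> \<exists>z\<in>P. coll_eq LL p z \<and> coll_eq LL p' z \<and> coll_eq LL x z \<and> \<not> coll_eq LL y z"
    and perp_pair_nonempty:
      "\<lbrakk>p \<in> P; p' \<in> P; \<not> coll_eq LL p p'\<rbrakk> \<Longrightarrow> \<exists>x\<in>P. coll_eq LL p x \<and> coll_eq LL p' x"
    and perp_pair_line:
      "\<lbrakk>p \<in> P; p' \<in> P; x \<in> P; \<not> coll_eq LL p p'; coll_eq LL p x; coll_eq LL p' x\<rbrakk>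
        \<Longrightarrow> \<exists>y\<in>P. y \<noteq> x \<and> coll_eq LL x y \<and> coll_eq LL p y \<and> coll_eq LL p' y"
begin

abbreviation orth (infix "\<bottom>" 50) where "x \<bottom> y \<equiv> coll_eq LL x y"

lemma line_through:
  assumes "x \<bottom> y" "x \<noteq> y"
  obtains L where "L \<in> LL" "x \<in> L" "y \<in> L"
  using assms by (auto simp: coll_eq_def collinear_def)

text \<open>The uniqueness half of the one-or-all property, with \<open>perp_meets_line\<close> as
  the existence half: two distinct such points would force \<open>x\<close> to be collinear with
  \<open>a\<close> too.\<close>

lemma perp_line_unique:
  assumes "L \<in> LL" "a \<in> L" "y \<in> L" "z \<in> L" "x \<in> P" "\<not> x \<bottom> a" "x \<bottom> y" "x \<bottom> z"
  shows "y = z"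
  using perp_line[of L y z a x] assms by blast

end

text \<open>\<open>domestic\<close> is the negation of opposition between a line and its image,
  spelled out for points.\<close>

locale line_domestic_collineation = polar_geometry P LL
  for P :: "'p set" and LL :: "'p set set" +
  fixes \<theta> :: "'p \<Rightarrow> 'p"
  assumes coll: "collineation P LL \<theta>"
    and domestic: "L \<in> LL \<Longrightarrow> \<exists>z\<in>L. \<forall>y\<in>L. z \<bottom> \<theta> y"
begin

section \<open>Moved points and the common perp of such a point and its image\<close>

definition moved :: "'p set" where
  "moved = {p \<in> P. \<not> p \<bottom> \<theta> p}"

text \<open>This is the set \<Gamma> of the overview, with the point as a parameter because later
  steps change it to another moved point.\<close>

definition base :: "'p \<Rightarrow> 'p set" where
  "base p = {x \<in> P. p \<bottom> x \<and> \<theta> p \<bottom> x}"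

lemma inj: "x \<in> P \<Longrightarrow> y \<in> P \<Longrightarrow> \<theta> x = \<theta> y \<longleftrightarrow> x = y"
  using coll by (auto simp: collineation_def bij_betw_def inj_on_def)

lemma in_P [simp]: "x \<in> P \<Longrightarrow> \<theta> x \<in> P"
  using coll by (auto simp: collineation_def bij_betw_def)

lemma image_line: "L \<in> LL \<Longrightarrow> \<theta> ` L \<in> LL"
  using coll line_subset by (auto simp: collineation_def)

lemma orth_image_iff:
  assumes "x \<in> P" "y \<in> P"
  shows "\<theta> x \<bottom> \<theta> y \<longleftrightarrow> x \<bottom> y"
proof
  assume "x \<bottom> y"
  then show "\<theta> x \<bottom> \<theta> y"
    using image_line by (auto simp: coll_eq_def collinear_def)
next
  assume h: "\<theta> x \<bottom> \<theta> y"
  show "x \<bottom> y"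
  proof (cases "x = y")
    case False
    then have "\<theta> x \<noteq> \<theta> y"
      using inj assms by simp
    with h obtain M where M: "M \<in> LL" "\<theta> x \<in> M" "\<theta> y \<in> M"
      by (rule line_through)
    \<comment> \<open>\<open>collineation\<close> is an equivalence for subsets of \<open>P\<close>,
      so the full preimage of the line \<open>M\<close> is again a line.\<close>
    define L where "L = {z \<in> P. \<theta> z \<in> M}"
    have "\<theta> ` P = P"
      using coll by (auto simp: collineation_def bij_betw_def)
    with line_subset[OF M(1)] have "\<theta> ` L = M"
      by (auto simp: L_def)
    moreover have "L \<subseteq> P"
      by (auto simp: L_def)
    ultimately have "L \<in> LL"
      using coll M(1) by (auto simp: collineation_def)
    moreover have "x \<in> L" "y \<in> L"
      using M assms by (auto simp: L_def)
    ultimately show ?thesis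
      by (rule coll_eq_on_line)
  qed simp
qed

lemma moved_image: "p \<in> moved \<Longrightarrow> \<theta> p \<in> moved"
  by (simp add: moved_def orth_image_iff)

text \<open>Domesticity of the line px yields a point \<open>z\<close> on it that is collinear with
  its whole image, in particular with \<theta> p. Since \<open>p\<close> is opposite \<theta> p, the
  only such point of px is \<open>x\<close>.\<close>

lemma base_orth_image:
  assumes "p \<in> moved" "x \<in> base p"
  shows "x \<bottom> \<theta> x"
proof -
  have p: "p \<in> P" "\<not> \<theta> p \<bottom> p"
    using assms by (auto simp: moved_def dest: coll_eq_sym)
  have x: "x \<in> P" "p \<bottom> x" "\<theta> p \<bottom> x"
    using assms by (auto simp: base_def)
  have "p \<noteq> x"
    using p x by auto
  then obtain L where L: "L \<in> LL" "p \<in> L" "x \<in> L"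
    using x line_through by metis
  obtain z where z: "z \<in> L" "\<forall>y\<in>L. z \<bottom> \<theta> y"
    using domestic[OF L(1)] by blast
  have "z = x"
    using perp_line_unique[OF L(1,2) z(1) L(3), of "\<theta> p"] p x z L by (auto dest: coll_eq_sym)
  with z L show ?thesis by simp
qed

text \<open>Otherwise the point given by domesticity of the line \<open>m\<close> = xy must be
  \<open>x\<close>. A third point \<open>w\<close> of \<open>m\<close> also lies in
  \<open>base p\<close>, so \<theta> w is collinear with \<open>w\<close> and \<open>x\<close>,
  hence with \<open>y\<close>. Then \<open>y\<close> is collinear with \<theta> w and \<theta> y,
  hence with \<theta> x.\<close>

lemma base_orth_image_orth:
  assumes p: "p \<in> moved" and x: "x \<in> base p" and y: "y \<in> base p" and xy: "x \<bottom> y"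
  shows "y \<bottom> \<theta> x"
proof (rule ccontr)
  assume neg: "\<not> y \<bottom> \<theta> x"
  have P: "p \<in> P" "x \<in> P" "y \<in> P"
    using p x y by (auto simp: moved_def base_def)
  have xx: "x \<bottom> \<theta> x" and yy: "y \<bottom> \<theta> y"
    using base_orth_image p x y by auto
  with neg have "x \<noteq> y" by auto
  with xy obtain m where m: "m \<in> LL" "x \<in> m" "y \<in> m"
    by (rule line_through)
  obtain z where z: "z \<in> m" "\<forall>w\<in>m. z \<bottom> \<theta> w"
    using domestic[OF m(1)] by blast
  have "z = x"
    using perp_line_unique[OF m(1,3) z(1) m(2), of "\<theta> x"] P z m xx neg
    by (auto dest: coll_eq_sym)
  obtain w where w: "w \<in> m" "w \<noteq> x" "w \<noteq> y"
    using fourth_point[OF m(1), of x y y] by auto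
  have wP: "w \<in> P"
    using w m line_subset by auto
  have "p \<bottom> w" "\<theta> p \<bottom> w"
    using perp_line[OF m w(1) \<open>x \<noteq> y\<close>] P x y by (auto simp: base_def)
  then have "w \<in> base p"
    using wP by (simp add: base_def)
  then have "\<theta> w \<bottom> w"
    using base_orth_image p coll_eq_sym by metis
  moreover have "\<theta> w \<bottom> x"
    using z \<open>z = x\<close> w coll_eq_sym by metis
  ultimately have "\<theta> w \<bottom> y"
    using perp_line[OF m(1) w(1) m(2) m(3) w(2)] wP by simp
  then have "y \<bottom> \<theta> w"
    by (rule coll_eq_sym)
  then have "y \<bottom> \<theta> x"
    using perp_line[OF image_line[OF m(1)], of "\<theta> w" "\<theta> y" "\<theta> x" y] yy w m P wP inj by auto
  with neg show False by simp
qed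

text \<open>The point \<open>y\<close> of the image of \<open>L\<close> collinear with
  \<open>p\<close> lies in \<Gamma> and is collinear with every point of \<Gamma> that is collinear
  with \<open>x\<close>. By \<open>separating_point\<close> this forces \<open>y\<close> =
  \<open>x\<close>.\<close>

lemma base_mem_image_line:
  assumes p: "p \<in> moved" and x: "x \<in> base p" and L: "L \<in> LL" "p \<in> L" "x \<in> L"
  shows "x \<in> \<theta> ` L"
proof -
  have P: "p \<in> P" "\<not> p \<bottom> \<theta> p" "x \<in> P" "p \<bottom> x" "\<theta> p \<bottom> x"
    using p x by (auto simp: moved_def base_def)
  have "p \<noteq> x"
    using P by (auto dest: coll_eq_sym)
  then have img: "\<theta> p \<noteq> \<theta> x"
    using inj P by simp
  note L' = image_line[OF L(1)]
  have mem: "\<theta> p \<in> \<theta> ` L" "\<theta> x \<in> \<theta> ` L"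
    using L by auto
  obtain y where y: "y \<in> \<theta> ` L" "p \<bottom> y"
    using perp_meets_line[OF L' P(1)] by blast
  have yP: "y \<in> P"
    using y line_subset[OF L'] by auto
  have "\<theta> p \<bottom> y"
    using coll_eq_on_line[OF L'] mem y by blast
  \<comment> \<open>Every point of \<Gamma> is collinear with \<theta> p, so collinearity with
    \<theta> x extends it to the whole image line.\<close>
  have on_image: "w \<bottom> y" if "w \<in> base p" "w \<bottom> \<theta> x" for w
    using perp_line[OF L' mem y(1) img, of w] that by (auto simp: base_def dest: coll_eq_sym)
  have "x = y"
  proof (rule ccontr)
    assume "x \<noteq> y"
    moreover have "x \<bottom> y"
      using on_image[OF x base_orth_image[OF p x]] .
    ultimately obtain z where z: "z \<in> P" "p \<bottom> z" "\<theta> p \<bottom> z" "x \<bottom> z" "\<not> y \<bottom> z"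
      using separating_point[of p "\<theta> p" x y] P yP y \<open>\<theta> p \<bottom> y\<close> by auto
    then have "z \<in> base p"
      by (simp add: base_def)
    then have "z \<bottom> y"
      using on_image base_orth_image_orth[OF p x] z by blast
    then show False
      using z coll_eq_sym by metis
  qed
  with y show ?thesis by simp
qed

text \<open>For a second moved point \<open>d\<close> on the line \<open>px\<close>, the point \<open>\<theta> y\<close> is on the images of both
  \<open>py\<close> and \<open>dy\<close>, which meet in \<open>y\<close>.\<close>

lemma base_fixed_aux:
  assumes p: "p \<in> moved" and x: "x \<in> base p" and y: "y \<in> base p"
    and xy: "x \<bottom> y" "x \<noteq> y"
  shows "\<theta> y = y"
proof (rule ccontr)
  assume neg: "\<theta> y \<noteq> y"
  have P: "p \<in> P" "\<not> p \<bottom> \<theta> p" "x \<in> P" "p \<bottom> x" "\<theta> p \<bottom> x" "y \<in> P" "p \<bottom> y" "\<theta> p \<bottom> y"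
    using p x y by (auto simp: moved_def base_def)
  have "p \<noteq> x" "p \<noteq> y"
    using P by (auto dest: coll_eq_sym)
  with P obtain L M where L: "L \<in> LL" "p \<in> L" "x \<in> L" and M: "M \<in> LL" "p \<in> M" "y \<in> M"
    by (metis line_through)
  have xL: "x \<in> \<theta> ` L" and yM: "y \<in> \<theta> ` M"
    using base_mem_image_line p x y L M by auto
  \<comment> \<open>Avoiding the preimage of \<open>x\<close> makes \<theta> d and \<open>x\<close>
    distinct points of the image of \<open>L\<close>; this choice takes four points on a
    line.\<close>
  obtain d where d: "d \<in> L" "d \<noteq> p" "d \<noteq> x" "d \<noteq> inv_into P \<theta> x"
    using fourth_point[OF L(1)] by blast
  have dP: "d \<in> P"
    using d L line_subset by auto
  have "\<theta> d \<noteq> x"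
    using d(4) dP coll by (auto simp: collineation_def bij_betw_def)
  have "\<theta> p \<noteq> x"
    using P by auto
  have not_xL: "\<not> d \<bottom> \<theta> p"
    using perp_line_unique[OF L(1) L(2) d(1) L(3), of "\<theta> p"] P d by (auto dest: coll_eq_sym)
  \<comment> \<open>If \<open>d\<close> were collinear with \<theta> d, then, being collinear with
    \<open>x\<close>, it would be collinear with the whole image of \<open>L\<close>, including
    \<theta> p.\<close>
  have "\<not> d \<bottom> \<theta> d"
    using perp_line[OF image_line[OF L(1)], of "\<theta> d" x "\<theta> p" d] not_xL dP xL d L
      \<open>\<theta> d \<noteq> x\<close> coll_eq_on_line[OF L(1)] by auto
  then have d_moved: "d \<in> moved"
    using dP by (simp add: moved_def)
  have "y \<bottom> d"
    using perp_line[OF L(1) L(2) L(3) d(1) \<open>p \<noteq> x\<close>, of y] P xy by (auto dest: coll_eq_sym)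
  moreover have "y \<bottom> \<theta> d"
    using perp_line[OF image_line[OF L(1)], of "\<theta> p" x "\<theta> d" y] P xy xL L d \<open>\<theta> p \<noteq> x\<close>
    by (auto dest: coll_eq_sym)
  ultimately have yd: "y \<in> base d"
    using P by (auto simp: base_def dest: coll_eq_sym)
  have "y \<noteq> d"
    using yd d_moved by (auto simp: base_def moved_def dest: coll_eq_sym)
  then obtain N where N: "N \<in> LL" "d \<in> N" "y \<in> N"
    using \<open>y \<bottom> d\<close> by (metis line_through)
  have yN: "y \<in> \<theta> ` N"
    using base_mem_image_line d_moved yd N by auto
  have MN: "\<theta> ` M = \<theta> ` N"
    using line_unique[OF image_line[OF M(1)] image_line[OF N(1)], of y "\<theta> y"] M N yM yN neg
    by auto
  \<comment> \<open>The images of \<open>L\<close> and \<open>M\<close> now share \<theta> p and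
    \<theta> d, so they coincide. This common line carries \<open>x\<close> and \<open>y\<close>,
    both collinear with \<open>p\<close>, although \<open>p\<close> is opposite its point \<theta>
    p.\<close>
  have "\<theta> d \<in> \<theta> ` M"
    using MN N by auto
  moreover have "\<theta> d \<noteq> \<theta> p"
    using inj d dP P by simp
  ultimately have "\<theta> ` L = \<theta> ` M"
    using line_unique[OF image_line[OF L(1)] image_line[OF M(1)], of "\<theta> d" "\<theta> p"] L M d
    by auto
  then have "x = y"
    using perp_line_unique[OF image_line[OF L(1)], of "\<theta> p" x y p] xL yM P L by auto
  with xy show False by simp
qed

lemma base_fixed:
  assumes "p \<in> moved" "x \<in> base p"
  shows "\<theta> x = x"
proof -
  have "p \<in> P" "\<not> p \<bottom> \<theta> p" "x \<in> P" "p \<bottom> x" "\<theta> p \<bottom> x"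
    using assms by (auto simp: moved_def base_def)
  then obtain y where "y \<in> base p" "y \<noteq> x" "y \<bottom> x"
    using perp_pair_line[of p "\<theta> p" x] by (auto simp: base_def dest: coll_eq_sym)
  then show ?thesis
    using base_fixed_aux assms by blast
qed

section \<open>Every point is fixed or opposite its image\<close>

lemma fixed_or_moved_orth:
  assumes p: "p \<in> moved" and r: "r \<in> P" "p \<bottom> r"
  shows "\<theta> r = r \<or> r \<in> moved"
proof (cases "r = p")
  case False
  with r obtain L where L: "L \<in> LL" "p \<in> L" "r \<in> L"
    by (metis line_through)
  have P: "p \<in> P" "\<not> p \<bottom> \<theta> p"
    using p by (auto simp: moved_def)
  obtain y where y: "y \<in> L" "\<theta> p \<bottom> y"
    using perp_meets_line[OF L(1), of "\<theta> p"] P by auto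
  have yP: "y \<in> P"
    using y L line_subset by auto
  have "y \<in> base p"
    using y yP coll_eq_on_line[OF L(1)] L by (simp add: base_def)
  then have fy: "\<theta> y = y"
    using base_fixed p by blast
  show ?thesis
  proof (cases "r = y")
    case False
    then have ne: "\<theta> r \<noteq> y"
      using inj r yP fy by metis
    have "y \<in> \<theta> ` L"
      using y fy by (metis imageI)
    \<comment> \<open>Otherwise \<open>r\<close> is collinear with the distinct points \<theta> r
      and \<open>y\<close> of the image line, hence with \<theta> p; but \<open>y\<close> is the
      only point of \<open>L\<close> collinear with \<theta> p.\<close>
    have "\<not> r \<bottom> \<theta> r"
    proof
      assume "r \<bottom> \<theta> r"
      then have "r \<bottom> \<theta> p"
        using perp_line[OF image_line[OF L(1)], of "\<theta> r" y "\<theta> p" r] ne \<open>y \<in> \<theta> ` L\<close> L r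
          coll_eq_on_line[OF L(1) L(3) y(1)] by auto
      then have "r = y"
        using perp_line_unique[OF L(1) L(2) L(3) y(1), of "\<theta> p"] P y by (auto dest: coll_eq_sym)
      with False show False by simp
    qed
    then show ?thesis
      using r by (simp add: moved_def)
  qed (use fy in simp)
qed (use p in simp)

lemma orth_fixed_image:
  assumes "x \<in> P" "s \<in> P" "\<theta> s = s" "x \<bottom> s"
  shows "\<theta> x \<bottom> s"
  using orth_image_iff[of x s] assms by simp

text \<open>If \<open>r\<close> were neither, then \<open>p\<close> and \<open>r\<close> would be
  opposite and every point collinear with both would be fixed, because a moved one would pass the
  dichotomy on to \<open>r\<close>. So \<theta> p lies in the double perp of \<open>p\<close> and
  \<open>r\<close>, which leaves only \<theta> p = \<open>r\<close>; but \<theta> p is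
  moved.\<close>

lemma fixed_or_moved:
  assumes p: "p \<in> moved" and r: "r \<in> P"
  shows "\<theta> r = r \<or> r \<in> moved"
proof (rule ccontr)
  assume neg: "\<not> ?thesis"
  have P: "p \<in> P" "\<not> p \<bottom> \<theta> p"
    using p by (auto simp: moved_def)
  have "\<not> p \<bottom> r"
    using fixed_or_moved_orth[OF p r] neg by blast
  moreover have "\<theta> p \<bottom> s" if s: "s \<in> P" "p \<bottom> s" "r \<bottom> s" for s
  proof -
    have "s \<notin> moved"
      using fixed_or_moved_orth[OF _ r] s neg coll_eq_sym by metis
    then have "\<theta> s = s"
      using fixed_or_moved_orth[OF p] s by blast
    then show ?thesis
      using orth_fixed_image P s by blast
  qed
  ultimately have "\<theta> p = p \<or> \<theta> p = r"
    using double_perp[of p r "\<theta> p"] P r by simp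
  then show False
    using P neg moved_image[OF p] by auto
qed

section \<open>The fixed hyperplane and the order of the collineation\<close>

definition fixed :: "'p set" where
  "fixed = {x \<in> P. \<theta> x = x}"

context
  fixes p
  assumes p: "p \<in> moved"
begin

text \<open>The image of a point \<open>z\<close> on a line with two fixed points is collinear with
  both of them, hence with \<open>z\<close>; by the dichotomy \<open>z\<close> is fixed.\<close>

lemma fixed_subspace: "geom_subspace P LL fixed"
proof -
  have "z \<in> fixed"
    if h: "L \<in> LL" "x \<in> L" "y \<in> L" "x \<in> fixed" "y \<in> fixed" "x \<noteq> y" "z \<in> L" for L x y z
  proof (rule ccontr)
    assume "z \<notin> fixed"
    moreover have z: "z \<in> P"
      using h line_subset by auto
    ultimately have "\<not> z \<bottom> \<theta> z"
      using fixed_or_moved[OF p z] by (auto simp: fixed_def moved_def)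
    moreover have "\<theta> z \<bottom> x" "\<theta> z \<bottom> y"
      using h z coll_eq_on_line[OF h(1)] orth_fixed_image by (auto simp: fixed_def)
    then have "\<theta> z \<bottom> z"
      using perp_line[OF h(1,2,3,7,6)] z by simp
    ultimately show False
      using coll_eq_sym by metis
  qed
  then show ?thesis
    unfolding geom_subspace_def by (auto simp: fixed_def)
qed

text \<open>On a line through a moved point \<open>a\<close>, the point collinear with \<theta> a
  lies in \<open>base a\<close> and is fixed. A line joining \<open>p\<close> to a point of
  \<open>base p\<close> has no second fixed point, since \<open>p\<close> is not fixed.\<close>

lemma fixed_hyperplane: "geometric_hyperplane P LL fixed"
  unfolding geometric_hyperplane_def
proof (intro conjI ballI)
  show "geom_subspace P LL fixed"
    by (rule fixed_subspace)
next
  fix L assume L: "L \<in> LL"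
  then obtain a where a: "a \<in> L"
    using fourth_point by blast
  then have aP: "a \<in> P"
    using L line_subset by auto
  show "L \<inter> fixed \<noteq> {}"
  proof (cases "\<theta> a = a")
    case True
    then show ?thesis
      using a aP by (auto simp: fixed_def)
  next
    case False
    then have a_moved: "a \<in> moved"
      using fixed_or_moved[OF p aP] by simp
    obtain y where y: "y \<in> L" "\<theta> a \<bottom> y"
      using perp_meets_line[OF L, of "\<theta> a"] aP by auto
    then have "y \<in> base a"
      using line_subset[OF L] coll_eq_on_line[OF L a y(1)] by (auto simp: base_def)
    then have "y \<in> fixed"
      using base_fixed[OF a_moved, of y] by (auto simp: fixed_def base_def)
    with y show ?thesis by auto
  qed
next
  have P: "p \<in> P" "\<not> p \<bottom> \<theta> p"
    using p by (auto simp: moved_def)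
  obtain x where x: "x \<in> P" "p \<bottom> x" "\<theta> p \<bottom> x"
    using perp_pair_nonempty[of p "\<theta> p"] P by auto
  then have fx: "\<theta> x = x"
    using base_fixed[OF p, of x] by (simp add: base_def)
  have "p \<noteq> x"
    using P x coll_eq_sym by metis
  then obtain L where L: "L \<in> LL" "p \<in> L" "x \<in> L"
    using x line_through by metis
  have "p \<notin> fixed"
    using P by (auto simp: fixed_def)
  have "x \<in> fixed"
    using fx x by (simp add: fixed_def)
  with \<open>p \<notin> fixed\<close> fixed_subspace L have "\<forall>y. y \<in> L \<inter> fixed \<longrightarrow> y = x"
    unfolding geom_subspace_def by blast
  with L \<open>x \<in> fixed\<close> show "\<exists>L\<in>LL. \<exists>!x. x \<in> L \<inter> fixed"
    by blast
qed

text \<open>If the fixed points were the perp of \<open>a\<close>, then \<open>a\<close> would be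
  collinear with all of \<open>base p\<close>, so \<open>a\<close> would be \<open>p\<close> or
  \<theta> p. But \<open>a\<close> lies in its own perp and neither of these points is
  fixed.\<close>

lemma fixed_nondegenerate: "nondegenerate_hyperplane P LL fixed"
proof -
  have P: "p \<in> P" "\<not> p \<bottom> \<theta> p"
    using p by (auto simp: moved_def)
  have False if a: "a \<in> P" "fixed = perp P LL a" for a
  proof -
    have "a \<in> fixed"
      using a by (auto simp: perp_def)
    have "a \<bottom> x" if "x \<in> P" "p \<bottom> x" "\<theta> p \<bottom> x" for x
    proof -
      have "x \<in> fixed"
        using base_fixed[OF p, of x] that by (auto simp: fixed_def base_def)
      then have "x \<bottom> a"
        using a by (auto simp: perp_def coll_eq_def)
      then show ?thesis
        by (rule coll_eq_sym)
    qed
    then have "a = p \<or> a = \<theta> p"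
      using double_perp[of p "\<theta> p" a] P a by auto
    then have "\<theta> p = p"
      using \<open>a \<in> fixed\<close> P inj[of "\<theta> p" p] by (auto simp: fixed_def)
    then show False
      using P by simp
  qed
  then show ?thesis
    using fixed_hyperplane by (auto simp: nondegenerate_hyperplane_def singular_hyperplane_def)
qed

text \<open>For moved \<open>r\<close> the points of \<open>base r\<close> are fixed, so \<theta>
  (\<theta> r) is collinear with all of them and hence is \<open>r\<close> or \<theta> r;
  injectivity excludes the latter.\<close>

lemma involution: "involution_on P \<theta>"
  unfolding involution_on_def
proof (intro conjI ballI)
  show "\<exists>x\<in>P. \<theta> x \<noteq> x"
    using p by (auto simp: moved_def intro!: bexI[of _ p])
next
  fix r assume r: "r \<in> P"
  show "\<theta> (\<theta> r) = r"
  proof (cases "\<theta> r = r")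
    case False
    then have m: "r \<in> moved"
      using fixed_or_moved[OF p r] by simp
    then have opp: "\<not> r \<bottom> \<theta> r"
      by (simp add: moved_def)
    have "\<theta> (\<theta> r) \<bottom> s" if s: "s \<in> P" "r \<bottom> s" "\<theta> r \<bottom> s" for s
      using base_fixed[OF m, of s] s r orth_fixed_image[of "\<theta> r" s] by (simp add: base_def)
    then have "\<theta> (\<theta> r) = r \<or> \<theta> (\<theta> r) = \<theta> r"
      using double_perp[of r "\<theta> r" "\<theta> (\<theta> r)"] r opp by auto
    then show ?thesis
      using False inj[of "\<theta> r" r] r by auto
  qed simp
qed

end

end

section \<open>The polar space of a quadric\<close>

text \<open>Rank at least 3 is stated without \<open>dim\<close>: some totally singular subspace is
  not covered by the span of two vectors.\<close>

locale quadric = vector_space scale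
  for scale :: "'k::field \<Rightarrow> 'v::ab_group_add \<Rightarrow> 'v" (infixr "*s" 75) +
  fixes q :: "'v \<Rightarrow> 'k"
  assumes quadratic: "quadratic_form scale q"
    and nondegenerate: "nondegenerate_form q"
    and two_neq_0: "(2::'k) \<noteq> 0"
    and singular_plane: "\<exists>U. totally_singular scale q U \<and> (\<forall>a b. \<not> U \<subseteq> span {a, b})"
begin

section \<open>The quadratic form and its polar form\<close>

abbreviation B where "B \<equiv> polar_form q"
abbreviation Q where "Q \<equiv> quadric_points scale q"
abbreviation LL where "LL \<equiv> quadric_lines scale q"

lemma q_scale [simp]: "q (a *s v) = a\<^sup>2 * q v"
  using quadratic by (simp add: quadratic_form_def)

lemma B_linear: "Vector_Spaces.linear scale (*) (B v)"
  using quadratic by (simp add: quadratic_form_def)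

lemma B_commute: "B v w = B w v"
  by (simp add: polar_form_def add.commute)

lemma B_add_right [simp]: "B v (w + u) = B v w + B v u"
  and B_scale_right [simp]: "B v (a *s w) = a * B v w"
  using B_linear[of v] by (simp_all add: Vector_Spaces.linear_iff)

lemma B_add_left [simp]: "B (w + u) v = B w v + B u v"
  and B_scale_left [simp]: "B (a *s w) v = a * B w v"
  using B_add_right B_scale_right B_commute by metis+

lemma B_zero_right [simp]: "B v 0 = 0"
  using B_scale_right[of v 0 0] by simp

lemma B_diff_right [simp]: "B v (w - u) = B v w - B v u"
  using B_add_right[of v "w - u" u] by (simp add: algebra_simps)

lemma B_diff_left [simp]: "B (w - u) v = B w v - B u v"
  using B_diff_right B_commute by metis

lemma q_add: "q (v + w) = q v + q w + B v w"
  by (simp add: polar_form_def)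

lemma B_self: "B v v = 2 * q v"
proof -
  have "v + v = 2 *s v"
    by (metis one_add_one scale_left_distrib scale_one)
  then have "B v v = 4 * q v - q v - q v"
    by (simp add: polar_form_def)
  then show ?thesis by simp
qed

lemma q_diff: "q (v - w) = q v + q w - B v w"
  using q_add[of "v - w" w] B_self[of w] by simp

text \<open>A vector in the radical of \<open>B\<close> satisfies 2 q v = B v v = 0, so it is
  singular in characteristic not 2, and nondegeneracy applies.\<close>

lemma exists_B_neq_0:
  assumes "v \<noteq> 0"
  obtains w where "B v w \<noteq> 0"
proof -
  have "q v = 0" if "\<forall>w. B v w = 0"
    using that B_self[of v] two_neq_0 by auto
  then show ?thesis
    using nondegenerate assms that unfolding nondegenerate_form_def by blast
qed

section \<open>Points and lines of the quadric in terms of vectors\<close>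

lemma span_pair_iff: "x \<in> span {u, v} \<longleftrightarrow> (\<exists>a b. x = a *s u + b *s v)"
  unfolding span_breakdown_eq[of x u "{v}"] span_singleton image_iff diff_eq_eq
  by (simp add: add.commute)

lemma span_pair_leftI [intro]: "u \<in> span {u, v}"
  and span_pair_rightI [intro]: "v \<in> span {u, v}"
  by (auto intro: span_base)

lemma subspace_singular_B:
  assumes "totally_singular scale q U" "v \<in> U" "w \<in> U"
  shows "B v w = 0"
  using assms by (simp add: polar_form_def totally_singular_def subspace_add)

lemma totally_singular_pair:
  assumes "q v = 0" "q w = 0" "B v w = 0"
  shows "totally_singular scale q (span {v, w})"
  using assms by (auto simp: totally_singular_def span_pair_iff q_add)

lemma pointI: "v \<noteq> 0 \<Longrightarrow> q v = 0 \<Longrightarrow> span {v} \<in> Q"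
  by (auto simp: quadric_points_def)

lemma pointE:
  assumes "p \<in> Q"
  obtains v where "p = span {v}" "v \<noteq> 0" "q v = 0"
  using assms by (auto simp: quadric_points_def)

lemma span_singleton_subset_iff: "subspace U \<Longrightarrow> span {v} \<subseteq> U \<longleftrightarrow> v \<in> U"
  by (meson span_base singletonI subset_iff span_minimal empty_subsetI insert_subset)

lemma span_singleton_eq_iff:
  assumes "v \<noteq> 0" "w \<noteq> 0"
  shows "span {v} = span {w} \<longleftrightarrow> w \<in> span {v}"
proof
  show "w \<in> span {v}" if "span {v} = span {w}"
    using that by (simp add: span_base)
next
  assume w: "w \<in> span {v}"
  then obtain a where a: "w = a *s v"
    by (auto simp: span_singleton)
  with assms have "a \<noteq> 0" by auto
  then have "v = (1 / a) *s w"
    using a by simp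
  then have "v \<in> span {w}"
    by (auto simp: span_singleton)
  with w show "span {v} = span {w}"
    by (simp add: span_singleton_subset_iff subset_antisym)
qed

lemma independent_pair:
  assumes "v \<noteq> 0" "w \<notin> span {v}"
  shows "independent {v, w}" "card {v, w} = 2"
proof -
  have "independent {w, v}"
    using assms independent_insertI[of w "{v}"] by simp
  then show "independent {v, w}"
    by (simp add: insert_commute)
  have "v \<noteq> w"
    using assms by (auto intro: span_base)
  then show "card {v, w} = 2" by simp
qed

text \<open>A vector of the larger span outside the smaller one would give three independent vectors
  in the span of two.\<close>

lemma span_pair_eq:
  assumes v: "v \<noteq> 0" "w \<notin> span {v}" and mem: "v \<in> span {a, b}" "w \<in> span {a, b}"
  shows "span {v, w} = span {a, b}"
proof (rule ccontr)
  assume "span {v, w} \<noteq> span {a, b}"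
  moreover have "span {v, w} \<subseteq> span {a, b}"
    using mem by (intro span_minimal) auto
  ultimately obtain z where z: "z \<in> span {a, b}" "z \<notin> span {v, w}"
    by auto
  have "independent {z, v, w}"
    using independent_insertI[OF z(2) independent_pair(1)[OF v]] .
  moreover have "{z, v, w} \<subseteq> span {a, b}"
    using z mem by auto
  ultimately have "card {z, v, w} \<le> card {a, b}"
    using independent_span_bound[of "{a, b}" "{z, v, w}"] by auto
  moreover have "z \<notin> {v, w}"
    using z by (auto intro: span_base)
  then have "card {z, v, w} = 3"
    using independent_pair[OF v] by (simp add: card_insert_if)
  moreover have "card {a, b} \<le> 2"
    by (simp add: card_insert_if)
  ultimately show False by simp
qed

lemma lineI:
  assumes "v \<noteq> 0" "w \<notin> span {v}" "q v = 0" "q w = 0" "B v w = 0"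
  shows "{p \<in> Q. p \<subseteq> span {v, w}} \<in> LL"
proof -
  have "dim (span {v, w}) = 2"
    using independent_pair[OF assms(1,2)] dim_span_eq_card_independent by metis
  then show ?thesis
    using totally_singular_pair[OF assms(3-5)] by (auto simp: quadric_lines_def)
qed

lemma lineE:
  assumes "L \<in> LL"
  obtains v w where "v \<noteq> 0" "w \<noteq> 0" "w \<notin> span {v}" "q v = 0" "q w = 0" "B v w = 0"
    "L = {p \<in> Q. p \<subseteq> span {v, w}}"
proof -
  obtain U where U: "totally_singular scale q U" "dim U = 2" "L = {p \<in> Q. p \<subseteq> U}"
    using assms by (auto simp: quadric_lines_def)
  obtain S where S: "S \<subseteq> U" "independent S" "U \<subseteq> span S" "card S = dim U"
    using basis_exists by blast
  with U obtain v w where vw: "S = {v, w}" "v \<noteq> w"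
    by (metis card_2_iff)
  have "subspace U"
    using U by (simp add: totally_singular_def)
  then have "span {v, w} = U"
    using S vw span_minimal by (metis subset_antisym)
  moreover have "independent {w, v}"
    using S vw by (simp add: insert_commute)
  then have "w \<notin> span {v}" "v \<noteq> 0" "w \<noteq> 0"
    using vw by (auto simp: independent_insert span_zero)
  moreover have "q v = 0" "q w = 0" "B v w = 0"
    using U S vw subspace_singular_B by (auto simp: totally_singular_def)
  ultimately show ?thesis
    using that[of v w] U(3) by simp
qed

text \<open>The dictionary between geometry and algebra: \<open>B\<close> vanishes on totally
  singular subspaces, and two orthogonal singular vectors span one.\<close>

lemma coll_eq_iff:
  assumes v: "v \<noteq> 0" "q v = 0" and w: "w \<noteq> 0" "q w = 0"
  shows "coll_eq LL (span {v}) (span {w}) \<longleftrightarrow> B v w = 0"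
proof
  assume "coll_eq LL (span {v}) (span {w})"
  then consider "span {v} = span {w}" | L where "L \<in> LL" "span {v} \<in> L" "span {w} \<in> L"
    by (auto simp: coll_eq_def collinear_def)
  then show "B v w = 0"
  proof cases
    case 1
    then have "w \<in> span {v}"
      by (simp add: span_base)
    then obtain a where "w = a *s v"
      by (auto simp: span_singleton)
    then show ?thesis
      using v by (simp add: B_self)
  next
    case 2
    then obtain U where "totally_singular scale q U" "span {v} \<subseteq> U" "span {w} \<subseteq> U"
      by (auto simp: quadric_lines_def)
    then show ?thesis
      by (meson subspace_singular_B span_base singletonI subsetD)
  qed
next
  assume B: "B v w = 0"
  show "coll_eq LL (span {v}) (span {w})"
  proof (cases "w \<in> span {v}")
    case True
    then show ?thesis
      using span_singleton_eq_iff[OF v(1) w(1)] by simp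
  next
    case False
    have "span {v} \<in> Q" "span {w} \<in> Q"
      using v w pointI by auto
    then show ?thesis
      using lineI[OF v(1) False v(2) w(2) B]
      by (intro coll_eq_on_line[of "{p \<in> Q. p \<subseteq> span {v, w}}"]) (simp_all add: span_singleton_subset_iff span_pair_leftI span_pair_rightI)
  qed
qed

lemma line_eq:
  assumes L: "L \<in> LL" "span {v} \<in> L" "span {w} \<in> L" and v: "v \<noteq> 0" and w: "w \<notin> span {v}"
  shows "L = {p \<in> Q. p \<subseteq> span {v, w}}"
proof -
  obtain a b where ab: "L = {p \<in> Q. p \<subseteq> span {a, b}}"
    by (rule lineE[OF L(1)]) blast
  have "v \<in> span {a, b}" "w \<in> span {a, b}"
    using L ab by (auto simp: span_singleton_subset_iff)
  then show ?thesis
    using span_pair_eq[OF v w] ab by simp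
qed

lemma Union_line:
  assumes "q v = 0" "q w = 0" "B v w = 0" "v \<noteq> 0"
  shows "\<Union>{p \<in> Q. p \<subseteq> span {v, w}} = span {v, w}"
proof -
  have "x \<in> \<Union>{p \<in> Q. p \<subseteq> span {v, w}}" if x: "x \<in> span {v, w}" for x
  proof -
    \<comment> \<open>The zero vector spans no point, but it belongs to every point, so
      \<open>v\<close> can represent it.\<close>
    define y where "y = (if x = 0 then v else x)"
    have "y \<noteq> 0" "y \<in> span {v, w}" "x \<in> span {y}"
      using x assms by (auto simp: y_def span_base span_zero)
    moreover have "q y = 0"
      using totally_singular_pair[OF assms(1-3)] \<open>y \<in> span {v, w}\<close>
      by (auto simp: totally_singular_def)
    ultimately show ?thesis
      using pointI[of y] span_singleton_subset_iff[of "span {v, w}" y] by blast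
  qed
  then show ?thesis by auto
qed

text \<open>Makes the domesticity clause of \<open>Diag_B1_1\<close> applicable to lines.\<close>

lemma singular_subspace_line:
  assumes L: "L \<in> LL"
  shows "singular_subspace Q LL L" "proj_dim scale L = 1"
proof -
  obtain v w where vw: "v \<noteq> 0" "w \<noteq> 0" "w \<notin> span {v}" "q v = 0" "q w = 0" "B v w = 0"
    "L = {p \<in> Q. p \<subseteq> span {v, w}}"
    by (rule lineE[OF L])
  have "dim (\<Union>L) = 2"
    using vw Union_line[of v w] independent_pair[OF vw(1,3)] dim_span_eq_card_independent
    by metis
  then show "proj_dim scale L = 1"
    by (simp add: proj_dim_def)
  have unique: "M = L" if M: "M \<in> LL" "x \<in> M \<inter> L" "y \<in> M \<inter> L" "x \<noteq> y" for M x y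
  proof -
    have "x \<in> Q" "y \<in> Q"
      using M vw by auto
    then obtain a b where ab: "x = span {a}" "a \<noteq> 0" "y = span {b}" "b \<noteq> 0"
      unfolding quadric_points_def by blast
    have b: "b \<notin> span {a}"
      using M(4) ab span_singleton_eq_iff by blast
    have "M = {p \<in> Q. p \<subseteq> span {a, b}}" "L = {p \<in> Q. p \<subseteq> span {a, b}}"
      using line_eq[OF _ _ _ ab(2) b] M(1-3) L ab(1,3) by blast+
    then show ?thesis by simp
  qed
  have "L \<subseteq> Q"
    using vw(7) by blast
  then have "geom_subspace Q LL L"
    unfolding geom_subspace_def using unique by blast
  moreover have "collinear LL x y" if "x \<in> L" "y \<in> L" for x y
    using that L unfolding collinear_def by blast
  ultimately show "singular_subspace Q LL L"
    unfolding singular_subspace_def by blast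
qed


section \<open>Counting dimensions in totally singular subspaces\<close>

lemma kernel_span:
  assumes U: "subspace U" and ker: "\<And>u. u \<in> U \<Longrightarrow> B x u = 0 \<Longrightarrow> u \<in> span S"
  obtains y where "U \<subseteq> span (insert y S)"
proof (cases "\<forall>u\<in>U. B x u = 0")
  case True
  then have "U \<subseteq> span (insert 0 S)"
    using ker by auto
  then show ?thesis
    by (rule that)
next
  case False
  then obtain y where y: "y \<in> U" "B x y \<noteq> 0"
    by auto
  have "u \<in> span (insert y S)" if "u \<in> U" for u
  proof -
    \<comment> \<open>Subtracting this multiple of \<open>y\<close> moves \<open>u\<close> into the
      kernel of \<open>B x\<close>, which has codimension at most 1 in \<open>U\<close>.\<close>
    have "u - (B x u / B x y) *s y \<in> span S"
      using U y that by (intro ker) (simp_all add: subspace_diff subspace_scale)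
    then show ?thesis
      by (auto simp: span_breakdown_eq)
  qed
  then show ?thesis
    using that by blast
qed

lemma big_subspace:
  obtains U where "subspace U" "\<And>u. u \<in> U \<Longrightarrow> q u = 0" "\<And>u w. u \<in> U \<Longrightarrow> w \<in> U \<Longrightarrow> B u w = 0"
    "\<And>a b. \<not> U \<subseteq> span {a, b}"
proof -
  obtain U where U: "totally_singular scale q U" "\<forall>a b. \<not> U \<subseteq> span {a, b}"
    using singular_plane by blast
  then show ?thesis
    using that[of U] subspace_singular_B[of U] by (simp add: totally_singular_def)
qed

text \<open>If the common kernel were zero, adding one vector for each of the two functionals would
  put \<open>U\<close> into the span of two vectors.\<close>

lemma singular_in_two_kernels:
  assumes U: "subspace U" "\<And>a b. \<not> U \<subseteq> span {a, b}"
  obtains u where "u \<in> U" "u \<noteq> 0" "B x u = 0" "B y u = 0"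
proof (rule ccontr)
  assume "\<not> thesis"
  with that have zero: "\<And>u. u \<in> U \<Longrightarrow> B x u = 0 \<Longrightarrow> B y u = 0 \<Longrightarrow> u = 0"
    by blast
  have sub: "subspace {u \<in> U. B x u = 0}"
    using U(1) by (simp add: subspace_def)
  obtain c where c: "{u \<in> U. B x u = 0} \<subseteq> span {c}"
    by (rule kernel_span[OF sub, of y "{}"]) (use zero in auto)
  obtain d where "U \<subseteq> span {d, c}"
    by (rule kernel_span[OF U(1), of x "{c}"]) (use c in auto)
  with U show False by blast
qed

section \<open>Points on a line in coordinates and the one-or-all property\<close>

lemma pair_coeffs:
  assumes "v \<noteq> 0" "w \<notin> span {v}" "x *s v = y *s w"
  shows "x = 0 \<and> y = 0"
proof -
  have "y = 0"
  proof (rule ccontr)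
    assume y: "y \<noteq> 0"
    then have "w = (1 / y) *s (y *s w)"
      by simp
    also have "\<dots> = (x / y) *s v"
      using assms(3)[symmetric] by simp
    finally show False
      using assms(2) by (auto simp: span_singleton)
  qed
  with assms show ?thesis by simp
qed

lemma span_combination_neq:
  assumes v: "v \<noteq> 0" "w \<notin> span {v}" and det: "a * d \<noteq> b * c"
  shows "span {a *s v + b *s w} \<noteq> span {c *s v + d *s w}"
proof
  assume "span {a *s v + b *s w} = span {c *s v + d *s w}"
  then have "c *s v + d *s w \<in> span {a *s v + b *s w}"
    by (simp add: span_base)
  then obtain k where "c *s v + d *s w = k *s (a *s v + b *s w)"
    by (auto simp: span_singleton)
  then have "(c - k * a) *s v = (k * b - d) *s w"
    by (simp add: algebra_simps)
  then have "c = k * a" "d = k * b"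
    using pair_coeffs[OF v] by (metis eq_iff_diff_eq_0)+
  with det show False by simp
qed

lemma combination_neq_0:
  assumes v: "v \<noteq> 0" "w \<notin> span {v}" and "a \<noteq> 0 \<or> b \<noteq> 0"
  shows "a *s v + b *s w \<noteq> 0"
proof
  assume "a *s v + b *s w = 0"
  then have "a *s v = (- b) *s w"
    by (simp add: eq_neg_iff_add_eq_0)
  then show False
    using pair_coeffs[OF v] assms(3) by fastforce
qed

lemma combination_on_line:
  assumes "v \<noteq> 0" "w \<notin> span {v}" "q v = 0" "q w = 0" "B v w = 0" "a \<noteq> 0 \<or> b \<noteq> 0"
  shows "span {a *s v + b *s w} \<in> {p \<in> Q. p \<subseteq> span {v, w}}"
proof -
  have "span {a *s v + b *s w} \<in> Q"
    using assms combination_neq_0 by (intro pointI) (auto simp: q_add)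
  moreover have "a *s v + b *s w \<in> span {v, w}"
    by (auto simp: span_pair_iff)
  ultimately show ?thesis
    by (simp add: span_singleton_subset_iff)
qed

text \<open>The points with coordinates (1,0), (0,1), (1,1) and (1,-1) are pairwise distinct because
  1 and -1 differ, so one of them avoids \<open>a\<close>, \<open>b\<close> and
  \<open>c\<close>.\<close>

lemma line_fourth_point:
  assumes "L \<in> LL"
  shows "\<exists>d\<in>L. d \<noteq> a \<and> d \<noteq> b \<and> d \<noteq> c"
proof -
  obtain v w where vw: "v \<noteq> 0" "w \<noteq> 0" "w \<notin> span {v}" "q v = 0" "q w = 0" "B v w = 0"
    "L = {p \<in> Q. p \<subseteq> span {v, w}}"
    using assms by (rule lineE)
  define f where "f x y = span {x *s v + y *s w}" for x y
  have "f x y \<in> L" if "x \<noteq> 0 \<or> y \<noteq> 0" for x y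
    using combination_on_line[OF vw(1,3-6) that] vw(7) by (simp add: f_def)
  then have mem: "f 1 0 \<in> L" "f 0 1 \<in> L" "f 1 1 \<in> L" "f 1 (- 1) \<in> L"
    by simp_all
  have neq: "f x y \<noteq> f x' y'" if "x * y' \<noteq> y * x'" for x y x' y'
    using span_combination_neq[OF vw(1,3) that] by (simp add: f_def)
  have "(1::'k) \<noteq> - 1"
    using two_neq_0 by (metis add.right_inverse one_add_one)
  then have "f 1 1 \<noteq> f 1 (- 1)"
    by (intro neq) auto
  moreover have "f 1 0 \<noteq> f 0 1" "f 1 0 \<noteq> f 1 1" "f 1 0 \<noteq> f 1 (- 1)"
    "f 0 1 \<noteq> f 1 1" "f 0 1 \<noteq> f 1 (- 1)"
    by (intro neq; simp)+
  ultimately show ?thesis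
    using mem by metis
qed

lemma line_meets_perp:
  assumes L: "L \<in> LL" and x: "x \<in> Q"
  shows "\<exists>y\<in>L. coll_eq LL x y"
proof -
  obtain v w where vw: "v \<noteq> 0" "w \<noteq> 0" "w \<notin> span {v}" "q v = 0" "q w = 0" "B v w = 0"
    "L = {p \<in> Q. p \<subseteq> span {v, w}}"
    using L by (rule lineE)
  obtain u where u: "x = span {u}" "u \<noteq> 0" "q u = 0"
    using x by (rule pointE)
  \<comment> \<open>A nontrivial solution of a B(u,v) + b B(u,w) = 0. The value 1 covers the case
    B(u,v) = 0, where \<open>z\<close> becomes \<open>v\<close>.\<close>
  define a b where "a = (if B u v = 0 then 1 else B u w)" and "b = - B u v"
  define z where "z = a *s v + b *s w"
  have ab: "a \<noteq> 0 \<or> b \<noteq> 0"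
    by (simp add: a_def b_def)
  have z: "z \<noteq> 0" "q z = 0" "span {z} \<in> L"
    using combination_neq_0[OF vw(1,3) ab] combination_on_line[OF vw(1,3-6) ab] vw
    by (auto simp: z_def q_add)
  have "B u z = 0"
    by (simp add: z_def a_def b_def)
  then have "coll_eq LL x (span {z})"
    using coll_eq_iff u z by simp
  with z show ?thesis by blast
qed

lemma perp_closed_line:
  assumes L: "L \<in> LL" "y \<in> L" "z \<in> L" "w \<in> L" "y \<noteq> z" and x: "x \<in> Q"
    and perp: "coll_eq LL x y" "coll_eq LL x z"
  shows "coll_eq LL x w"
proof -
  have "y \<in> Q" "z \<in> Q" "w \<in> Q"
    using L by (auto simp: quadric_lines_def)
  obtain a where a: "x = span {a}" "a \<noteq> 0" "q a = 0"
    using x by (rule pointE)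
  obtain b where b: "y = span {b}" "b \<noteq> 0" "q b = 0"
    using \<open>y \<in> Q\<close> by (rule pointE)
  obtain c where c: "z = span {c}" "c \<noteq> 0" "q c = 0"
    using \<open>z \<in> Q\<close> by (rule pointE)
  obtain d where d: "w = span {d}" "d \<noteq> 0" "q d = 0"
    using \<open>w \<in> Q\<close> by (rule pointE)
  have "c \<notin> span {b}"
    using b c L(5) span_singleton_eq_iff by blast
  then have "L = {p \<in> Q. p \<subseteq> span {b, c}}"
    using line_eq[of L b c] L b c by simp
  then have "d \<in> span {b, c}"
    using L d by (auto simp: span_singleton_subset_iff)
  then obtain \<beta> \<gamma> where "d = \<beta> *s b + \<gamma> *s c"
    by (auto simp: span_pair_iff)
  then show ?thesis
    using perp a b c d coll_eq_iff by simp
qed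

lemma two_points_unique_line:
  assumes "L \<in> LL" "M \<in> LL" "x \<in> L" "y \<in> L" "x \<in> M" "y \<in> M" "x \<noteq> y"
  shows "L = M"
proof -
  have Q: "x \<in> Q" "y \<in> Q"
    using assms by (auto simp: quadric_lines_def)
  obtain a where a: "x = span {a}" "a \<noteq> 0" "q a = 0"
    using Q(1) by (rule pointE)
  obtain b where b: "y = span {b}" "b \<noteq> 0" "q b = 0"
    using Q(2) by (rule pointE)
  have ba: "b \<notin> span {a}"
    using a b assms(7) span_singleton_eq_iff by blast
  show ?thesis
    using line_eq[of L a b, OF _ _ _ a(2) ba] line_eq[of M a b, OF _ _ _ a(2) ba] assms a b
    by simp
qed

section \<open>The orthogonal complement of a hyperbolic pair\<close>

context
  fixes e f
  assumes e: "q e = 0" and f: "q f = 0" and ef: "B e f \<noteq> 0"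
begin

lemma hyperbolic_decomposition:
  obtains \<alpha> \<beta> w where "v = \<alpha> *s e + \<beta> *s f + w" "B e w = 0" "B f w = 0"
proof -
  define w where "w = v - (B v f / B e f) *s e - (B v e / B e f) *s f"
  have "B e w = 0" "B f w = 0"
    using ef by (simp_all add: w_def B_self e f B_commute)
  moreover have "v = (B v f / B e f) *s e + (B v e / B e f) *s f + w"
    by (simp add: w_def)
  ultimately show ?thesis
    using that by blast
qed

text \<open>Since \<open>w\<close> is orthogonal to \<open>e\<close> and \<open>f\<close>, only the
  complement component of a vector contributes to its product with \<open>w\<close>.\<close>

lemma complement_nondegenerate:
  assumes w: "B e w = 0" "B f w = 0" "w \<noteq> 0"
  obtains t where "B e t = 0" "B f t = 0" "B w t \<noteq> 0"
proof -
  obtain v where "B w v \<noteq> 0"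
    using exists_B_neq_0[OF w(3)] .
  moreover obtain \<alpha> \<beta> t where "v = \<alpha> *s e + \<beta> *s f + t" "B e t = 0" "B f t = 0"
    by (rule hyperbolic_decomposition)
  ultimately show ?thesis
    using that w by (simp add: B_commute)
qed

lemma complement_singular:
  obtains s where "s \<noteq> 0" "q s = 0" "B e s = 0" "B f s = 0"
proof -
  obtain U where U: "subspace U" "\<And>u. u \<in> U \<Longrightarrow> q u = 0" "\<And>a b. \<not> U \<subseteq> span {a, b}"
    using big_subspace by metis
  obtain s where "s \<in> U" "s \<noteq> 0" "B e s = 0" "B f s = 0"
    using U(1,3) by (rule singular_in_two_kernels)
  then show ?thesis
    using that U(2) by blast
qed

lemma complement_singular_not_orth:
  assumes w: "B e w = 0" "B f w = 0" "w \<noteq> 0"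
  obtains s where "s \<noteq> 0" "q s = 0" "B e s = 0" "B f s = 0" "B w s \<noteq> 0"
proof -
  obtain s0 where s0: "s0 \<noteq> 0" "q s0 = 0" "B e s0 = 0" "B f s0 = 0"
    by (rule complement_singular)
  show ?thesis
  proof (cases "B w s0 = 0")
    case False
    then show ?thesis using that s0 by blast
  next
    case True
    obtain t where t: "B e t = 0" "B f t = 0" "B w t \<noteq> 0"
      using w by (rule complement_nondegenerate)
    obtain t' where t': "B e t' = 0" "B f t' = 0" "B s0 t' \<noteq> 0"
      using s0(3,4,1) by (rule complement_nondegenerate)
    \<comment> \<open>Neither hyperplane, of \<open>w\<close> or of \<open>s0\<close>, contains the
      complement: if both \<open>t\<close> and \<open>t'\<close> fail, each lies in the hyperplane
      that the other avoids, and their sum lies in neither.\<close>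
    obtain r where r: "B e r = 0" "B f r = 0" "B w r \<noteq> 0" "B s0 r \<noteq> 0"
    proof (cases "B s0 t = 0 \<and> B w t' = 0")
      case True
      then show ?thesis
        using that[of "t + t'"] t t' by simp
    next
      case False
      then show ?thesis
        using that[of t] that[of t'] t t' by blast
    qed
    \<comment> \<open>Moving \<open>r\<close> along the singular vector \<open>s0\<close> onto the
      quadric; the product with \<open>w\<close> is unchanged because \<open>w\<close> is orthogonal
      to \<open>s0\<close>.\<close>
    define s where "s = r - (q r / B r s0) *s s0"
    have "q s = 0"
      using r s0 by (simp add: s_def q_diff B_commute)
    moreover have "B e s = 0" "B f s = 0" "B w s \<noteq> 0"
      using r s0 True by (simp_all add: s_def)
    moreover from this have "s \<noteq> 0" by auto
    ultimately show ?thesis using that by blast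
  qed
qed

lemma complement_separate:
  assumes a: "B e a = 0" "B f a = 0" "a \<noteq> 0" and b: "B e b = 0" "B f b = 0" "q b = 0"
    and ab: "B a b = 0" "b \<notin> span {a}"
  obtains t where "t \<noteq> 0" "q t = 0" "B e t = 0" "B f t = 0" "B a t = 0" "B b t \<noteq> 0"
proof -
  obtain t0 where t0: "B e t0 = 0" "B f t0 = 0" "B a t0 \<noteq> 0"
    using a by (rule complement_nondegenerate)
  \<comment> \<open>With this value b - \<kappa> a is orthogonal to \<open>t0\<close>. So correcting
    \<open>t1\<close> by a multiple of \<open>t0\<close> to make it orthogonal to \<open>a\<close>
    keeps its product with b - \<kappa> a, and that product becomes B b t2.\<close>
  define \<kappa> where "\<kappa> = B b t0 / B a t0"
  have "b - \<kappa> *s a \<noteq> 0"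
    using ab(2) by (auto simp: span_singleton)
  moreover have "B e (b - \<kappa> *s a) = 0" "B f (b - \<kappa> *s a) = 0"
    using a b by simp_all
  ultimately obtain t1 where t1: "B e t1 = 0" "B f t1 = 0" "B (b - \<kappa> *s a) t1 \<noteq> 0"
    using complement_nondegenerate by metis
  define t2 where "t2 = t1 - (B a t1 / B a t0) *s t0"
  have t2: "B e t2 = 0" "B f t2 = 0" "B a t2 = 0" "B b t2 \<noteq> 0"
    using t0 t1 by (auto simp: t2_def \<kappa>_def field_simps)
  \<comment> \<open>Moves \<open>t2\<close> along \<open>b\<close> onto the quadric; as
    \<open>b\<close> is singular and orthogonal to \<open>a\<close>, the products with
    \<open>a\<close> and \<open>b\<close> do not change.\<close>
  define t where "t = t2 - (q t2 / B b t2) *s b"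
  have "q t = 0"
    using t2 b by (simp add: t_def q_diff B_commute)
  moreover have "B e t = 0" "B f t = 0" "B a t = 0" "B b t \<noteq> 0"
    using t2 a b ab by (simp_all add: t_def B_self)
  moreover from this have "t \<noteq> 0" by auto
  ultimately show ?thesis using that by blast
qed

text \<open>If \<open>U \<inter> \<langle>e, a\<rangle>\<^sup>\<perp> \<subseteq> \<langle>e, a\<rangle>\<close> then a nonzero vector \<open>u\<close> of that intersection is
  orthogonal to \<open>U\<close>, so on \<open>U\<close> one of the conditions of being orthogonal to \<open>e\<close> and to \<open>a\<close> implies
  the other; the intersection is then too large.\<close>

lemma complement_line:
  assumes a: "B e a = 0" "B f a = 0" "a \<noteq> 0" "q a = 0"
  obtains s where "q s = 0" "B e s = 0" "B f s = 0" "B a s = 0" "s \<notin> span {a}"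
proof -
  obtain U where U: "subspace U" "\<And>u. u \<in> U \<Longrightarrow> q u = 0"
    "\<And>u w. u \<in> U \<Longrightarrow> w \<in> U \<Longrightarrow> B u w = 0" "\<And>a b. \<not> U \<subseteq> span {a, b}"
    using big_subspace by metis
  have "\<exists>u\<in>U. B e u = 0 \<and> B a u = 0 \<and> u \<notin> span {e, a}"
  proof (rule ccontr)
    assume "\<not> ?thesis"
    then have K: "u \<in> span {e, a}" if "u \<in> U" "B e u = 0" "B a u = 0" for u
      using that by blast
    obtain u where u: "u \<in> U" "u \<noteq> 0" "B e u = 0" "B a u = 0"
      using U(1,4) by (rule singular_in_two_kernels)
    \<comment> \<open>The common kernel in \<open>U\<close> is only a line: a second independent
      vector would put \<open>e\<close> and \<open>a\<close> into \<open>U\<close>, making all of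
      \<open>U\<close> orthogonal to both and thus contained in their span.\<close>
    have K': "w \<in> span {u}" if w: "w \<in> U" "B e w = 0" "B a w = 0" for w
    proof (rule ccontr)
      assume "w \<notin> span {u}"
      then have eq: "span {u, w} = span {e, a}"
        using u w K by (intro span_pair_eq) auto
      have "span {u, w} \<subseteq> U"
        using u w U(1) by (intro span_minimal) auto
      then have "e \<in> U" "a \<in> U"
        using eq by (auto intro: span_base)
      then have "U \<subseteq> span {e, a}"
        using K U(3) by blast
      then show False using U(4) by blast
    qed
    obtain x y where xy: "u = x *s e + y *s a"
      using K[OF u(1,3,4)] by (auto simp: span_pair_iff)
    have "x * B e w + y * B a w = 0" if "w \<in> U" for w
      using U(3)[OF u(1) that] by (simp add: xy)
    then consider "\<And>w. w \<in> U \<Longrightarrow> B e w = 0 \<Longrightarrow> B a w = 0"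
      | "\<And>w. w \<in> U \<Longrightarrow> B a w = 0 \<Longrightarrow> B e w = 0"
      using u(2) xy by (cases "y = 0") fastforce+
    then obtain z where "\<And>w. w \<in> U \<Longrightarrow> B z w = 0 \<Longrightarrow> w \<in> span {u}"
      using K' by cases blast+
    then obtain d where "U \<subseteq> span {d, u}"
      using kernel_span[OF U(1), of z "{u}"] by blast
    then show False using U(4) by blast
  qed
  then obtain u where u: "u \<in> U" "B e u = 0" "B a u = 0" "u \<notin> span {e, a}"
    by blast
  \<comment> \<open>Subtracting a multiple of \<open>e\<close> makes the vector orthogonal to
    \<open>f\<close>; it stays singular because \<open>u\<close> and \<open>e\<close> are orthogonal
    singular vectors.\<close>
  define c where "c = B f u / B e f"
  define s where "s = u - c *s e"
  have "q s = 0"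
    using u U(2) e by (simp add: s_def q_diff B_commute)
  moreover have "B e s = 0" "B f s = 0" "B a s = 0"
    using u ef e a by (simp_all add: s_def c_def B_self B_commute)
  moreover have "s \<notin> span {a}"
  proof
    assume "s \<in> span {a}"
    then have "u \<in> span {e, a}"
      by (auto simp: s_def span_breakdown_eq)
    with u show False by simp
  qed
  ultimately show ?thesis using that by blast
qed

text \<open>The complement component of \<open>v\<close> vanishes by
  \<open>complement_singular_not_orth\<close>. Then q v = 0 reads \<alpha> \<beta> B(e,f) = 0, so
  one coefficient is zero.\<close>

lemma double_complement:
  assumes v: "q v = 0" and orth: "\<And>s. \<lbrakk>s \<noteq> 0; q s = 0; B e s = 0; B f s = 0\<rbrakk> \<Longrightarrow> B v s = 0"
  shows "v \<in> span {e} \<or> v \<in> span {f}"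
proof -
  obtain \<alpha> \<beta> w where v_eq: "v = \<alpha> *s e + \<beta> *s f + w" and w: "B e w = 0" "B f w = 0"
    by (rule hyperbolic_decomposition)
  have "w = 0"
  proof (rule ccontr)
    assume "w \<noteq> 0"
    with w obtain s where s: "s \<noteq> 0" "q s = 0" "B e s = 0" "B f s = 0" "B w s \<noteq> 0"
      by (rule complement_singular_not_orth)
    with orth[of s] show False
      by (simp add: v_eq)
  qed
  with v have "\<alpha> * \<beta> * B e f = 0"
    by (auto simp: v_eq q_add e f)
  with ef have "\<alpha> = 0 \<or> \<beta> = 0" by simp
  with v_eq \<open>w = 0\<close> show ?thesis
    by (auto simp: span_singleton)
qed

end

section \<open>The quadric as a polar geometry, and domesticity of its lines\<close>

lemma opposite_pairE:
  assumes "p \<in> Q" "p' \<in> Q" "\<not> coll_eq LL p p'"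
  obtains e f where "p = span {e}" "e \<noteq> 0" "q e = 0" "p' = span {f}" "f \<noteq> 0" "q f = 0" "B e f \<noteq> 0"
proof -
  obtain e where e: "p = span {e}" "e \<noteq> 0" "q e = 0"
    using assms(1) by (rule pointE)
  obtain f where f: "p' = span {f}" "f \<noteq> 0" "q f = 0"
    using assms(2) by (rule pointE)
  show ?thesis
    using that[OF e f] assms(3) coll_eq_iff e f by simp
qed

text \<open>After the facts about single lines, each goal represents the opposite points by a
  hyperbolic pair and reduces to a lemma about its complement.\<close>

sublocale polar_geometry Q LL
proof
  show "L \<subseteq> Q" if "L \<in> LL" for L
    using that by (auto simp: quadric_lines_def)
  show "L = M"
    if "L \<in> LL" "M \<in> LL" "x \<in> L" "y \<in> L" "x \<in> M" "y \<in> M" "x \<noteq> y" for L M x y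
    using that by (rule two_points_unique_line)
  show "coll_eq LL x w"
    if "L \<in> LL" "y \<in> L" "z \<in> L" "w \<in> L" "y \<noteq> z" "x \<in> Q" "coll_eq LL x y" "coll_eq LL x z"
    for L x y z w
    using that by (rule perp_closed_line)
  show "\<exists>y\<in>L. coll_eq LL x y" if "L \<in> LL" "x \<in> Q" for L x
    using that by (rule line_meets_perp)
  show "\<exists>d\<in>L. d \<noteq> a \<and> d \<noteq> b \<and> d \<noteq> c" if "L \<in> LL" for L a b c
    using that by (rule line_fourth_point)
next
  fix p p' r
  assume h: "p \<in> Q" "p' \<in> Q" "r \<in> Q" "\<not> coll_eq LL p p'"
    and r: "\<And>x. \<lbrakk>x \<in> Q; coll_eq LL p x; coll_eq LL p' x\<rbrakk> \<Longrightarrow> coll_eq LL r x"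
  obtain e f where ef: "p = span {e}" "e \<noteq> 0" "q e = 0" "p' = span {f}" "f \<noteq> 0" "q f = 0"
    "B e f \<noteq> 0"
    using h(1,2,4) by (rule opposite_pairE)
  obtain v where v: "r = span {v}" "v \<noteq> 0" "q v = 0"
    using h(3) by (rule pointE)
  have "B v s = 0" if "s \<noteq> 0" "q s = 0" "B e s = 0" "B f s = 0" for s
    using r[of "span {s}"] pointI[of s] that ef v coll_eq_iff by simp
  then have "v \<in> span {e} \<or> v \<in> span {f}"
    using double_complement[OF ef(3,6,7) v(3)] by blast
  then show "r = p \<or> r = p'"
    using ef v span_singleton_eq_iff by metis
next
  fix p p' x y
  assume h: "p \<in> Q" "p' \<in> Q" "x \<in> Q" "y \<in> Q" "\<not> coll_eq LL p p'" "x \<noteq> y" "coll_eq LL x y"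
    "coll_eq LL p x" "coll_eq LL p' x" "coll_eq LL p y" "coll_eq LL p' y"
  obtain e f where ef: "p = span {e}" "e \<noteq> 0" "q e = 0" "p' = span {f}" "f \<noteq> 0" "q f = 0"
    "B e f \<noteq> 0"
    using h(1,2,5) by (rule opposite_pairE)
  obtain a where a: "x = span {a}" "a \<noteq> 0" "q a = 0"
    using h(3) by (rule pointE)
  obtain b where b: "y = span {b}" "b \<noteq> 0" "q b = 0"
    using h(4) by (rule pointE)
  have perp: "B e a = 0" "B f a = 0" "B e b = 0" "B f b = 0" "B a b = 0"
    using h ef a b coll_eq_iff by simp_all
  have "b \<notin> span {a}"
    using h a b span_singleton_eq_iff by blast
  then obtain t where t: "t \<noteq> 0" "q t = 0" "B e t = 0" "B f t = 0" "B a t = 0" "B b t \<noteq> 0"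
    using complement_separate[OF ef(3,6,7) perp(1,2) a(2) perp(3,4) b(3) perp(5)] by metis
  then show "\<exists>z\<in>Q. coll_eq LL p z \<and> coll_eq LL p' z \<and> coll_eq LL x z \<and> \<not> coll_eq LL y z"
    using ef a b coll_eq_iff pointI[of t] by (intro bexI[of _ "span {t}"]) simp_all
next
  fix p p'
  assume h: "p \<in> Q" "p' \<in> Q" "\<not> coll_eq LL p p'"
  obtain e f where ef: "p = span {e}" "e \<noteq> 0" "q e = 0" "p' = span {f}" "f \<noteq> 0" "q f = 0"
    "B e f \<noteq> 0"
    using h by (rule opposite_pairE)
  obtain s where "s \<noteq> 0" "q s = 0" "B e s = 0" "B f s = 0"
    using ef(3,6,7) by (rule complement_singular)
  then show "\<exists>x\<in>Q. coll_eq LL p x \<and> coll_eq LL p' x"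
    using ef coll_eq_iff pointI[of s] by (intro bexI[of _ "span {s}"]) simp_all
next
  fix p p' x
  assume h: "p \<in> Q" "p' \<in> Q" "x \<in> Q" "\<not> coll_eq LL p p'" "coll_eq LL p x" "coll_eq LL p' x"
  obtain e f where ef: "p = span {e}" "e \<noteq> 0" "q e = 0" "p' = span {f}" "f \<noteq> 0" "q f = 0"
    "B e f \<noteq> 0"
    using h(1,2,4) by (rule opposite_pairE)
  obtain a where a: "x = span {a}" "a \<noteq> 0" "q a = 0"
    using h(3) by (rule pointE)
  have perp: "B e a = 0" "B f a = 0"
    using h ef a coll_eq_iff by simp_all
  obtain s where s: "q s = 0" "B e s = 0" "B f s = 0" "B a s = 0" "s \<notin> span {a}"
    using ef(3,6,7) perp a(2,3) by (rule complement_line)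
  moreover from this have "s \<noteq> 0"
    by (auto simp: span_zero)
  ultimately show "\<exists>y\<in>Q. y \<noteq> x \<and> coll_eq LL x y \<and> coll_eq LL p y \<and> coll_eq LL p' y"
    using ef a coll_eq_iff pointI[of s] span_singleton_eq_iff[of a s]
    by (intro bexI[of _ "span {s}"]) auto
qed

lemma line_domestic:
  assumes coll: "collineation Q LL \<theta>" and diag: "Diag_B1_1 scale q \<theta>" and L: "L \<in> LL"
  shows "\<exists>z\<in>L. \<forall>y\<in>L. coll_eq LL z (\<theta> y)"
proof -
  have L': "\<theta> ` L \<in> LL"
    using coll L line_subset by (auto simp: collineation_def)
  have "\<not> opposite_subspaces scale q L (\<theta> ` L)"
    using diag singular_subspace_line[OF L] by (simp add: Diag_B1_1_def)
  then show ?thesis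
    using singular_subspace_line(2)[OF L] singular_subspace_line(2)[OF L']
    by (auto simp: opposite_subspaces_def opposite_points_iff)
qed

end

section \<open>Application to orthogonal polar spaces\<close>

lemma quadric_of_orthogonal_polar_space:
  fixes scale :: "'k::field \<Rightarrow> 'v::ab_group_add \<Rightarrow> 'v"
  assumes "orthogonal_polar_space scale q n" "n \<ge> 3" "CHAR('k) \<noteq> 2"
  shows "quadric scale q"
proof -
  interpret vector_space scale
    using assms(1) by (simp add: orthogonal_polar_space_def)
  obtain S where S: "independent S" "totally_singular scale q (span S)" "finite S" "card S = n"
    using assms(1) by (auto simp: orthogonal_polar_space_def has_witt_index_def)
  have "\<not> span S \<subseteq> span {a, b}" for a b
  proof
    assume "span S \<subseteq> span {a, b}"
    then have "S \<subseteq> span {a, b}"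
      using span_superset by blast
    then have "card S \<le> card {a, b}"
      using independent_span_bound[of "{a, b}" S] S by simp
    also have "\<dots> \<le> 2"
      by (simp add: card_insert_if)
    finally show False
      using S assms by simp
  qed
  moreover have "(2::'k) \<noteq> 0"
  proof
    assume "(2::'k) = 0"
    then have "of_nat 2 = (0::'k)"
      by simp
    \<comment> \<open>The divisors of 2 are 1 and 2. A field does not have characteristic 1, and
      \<open>CHAR\<close> = 0, standing for characteristic zero, does not divide 2.\<close>
    then have "CHAR('k) dvd 2"
      by (simp only: of_nat_eq_0_iff_char_dvd)
    moreover have "CHAR('k) \<noteq> 1"
      by simp
    ultimately have "CHAR('k) \<noteq> 0" "CHAR('k) \<noteq> 1" "CHAR('k) \<le> 2"
      using dvd_imp_le[of "CHAR('k)" 2] by (auto intro!: gr0I)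
    with assms(3) show False
      by presburger
  qed
  ultimately show ?thesis
    using assms(1) S(2)
    by unfold_locales (auto simp: orthogonal_polar_space_def)
qed

theorem proposition2p5:
  fixes scale :: "'k::field \<Rightarrow> 'v::ab_group_add \<Rightarrow> 'v"
    and q :: "'v \<Rightarrow> 'k"
    and n :: nat
    and \<theta> :: "'v set \<Rightarrow> 'v set"
  assumes "orthogonal_polar_space scale q n"
    and "n \<ge> 3"
    and "CHAR('k) \<noteq> 2"
    and "collineation (quadric_points scale q) (quadric_lines scale q) \<theta>"
    and "Diag_B1_1 scale q \<theta>"
  shows "(\<exists>H. nondegenerate_hyperplane (quadric_points scale q) (quadric_lines scale q) H \<and>
              (\<forall>x\<in>H. \<theta> x = x)) \<and>
         involution_on (quadric_points scale q) \<theta>"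
proof -
  interpret quadric scale q
    using assms(1-3) by (rule quadric_of_orthogonal_polar_space)
  interpret line_domestic_collineation Q LL \<theta>
    using assms(4) line_domestic[OF assms(4,5)] by unfold_locales
  \<comment> \<open>The first clause of \<open>Diag_B1_1\<close> supplies the moved point from which
    both conclusions are derived.\<close>
  obtain p where "p \<in> moved"
    using assms(5) by (auto simp: Diag_B1_1_def opposite_points_iff moved_def)
  then have "nondegenerate_hyperplane Q LL fixed" "involution_on Q \<theta>"
    by (rule fixed_nondegenerate, rule involution)
  moreover have "\<forall>x\<in>fixed. \<theta> x = x"
    by (simp add: fixed_def)
  ultimately show ?thesis by blast
qed

end
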